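(* Let $r\ge 1$, $\beta>0$, and let $c_1,\ldots,c_r\in(0,1)$ with $c_i\neq c_j$ whenever $i\neq j$. Let $M^{(1)}_{\vec n}$, $\vec n=(n_1,\ldots,n_r)\in\mathbb{N}^r$, be the multiple Meixner polynomials of the first kind with parameters $\beta$ and $c_1,\ldots,c_r$. Then for every $\vec n\in\mathbb{N}^r$ and every $k\in\{1,\ldots,r\}$, $$xM^{(1)}_{\vec n}(x)=M^{(1)}_{\vec n+\vec e_k}(x)+\left((\beta+|\vec n|)\frac{c_k}{1-c_k}+\sum_{i=1}^r\frac{n_i}{1-c_i}\right)M^{(1)}_{\vec n}(x)+\sum_{j=1}^r\frac{c_jn_j}{(1-c_j)^2}(\beta+|\vec n|-1)\,M^{(1)}_{\vec n-\vec e_j}(x).$$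
   Context: $\mathbb{N}=\{0,1,2,\ldots\}$. For $\vec n=(n_1,\ldots,n_r)\in\mathbb{N}^r$, $|\vec n|=n_1+\cdots+n_r$; $\vec e_k=(0,\ldots,0,1,0,\ldots,0)$ is the $k$th unit vector in $\mathbb{N}^r$. The Pochhammer symbol is $(a)_0=1$, $(a)_k=a(a+1)\cdots(a+k-1)$. The multiple Meixner polynomial of the first kind $M^{(1)}_{\vec n}$ (with parameters $\beta>0$ and $0<c_i\neq c_j<1$ for $i\ne j$) is the unique monic polynomial of degree $|\vec n|$ in one variable satisfying $$\sum_{k=0}^\infty M^{(1)}_{\vec n}(k)\,k^\ell\,\frac{(\beta)_k c_j^k}{k!}=0,\qquad \ell=0,1,\ldots,n_j-1,\quad j=1,\ldots,r.$$ Terms in the last sum with $n_j=0$ are understood to be $0$. *)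

theory Defs
  imports "HOL-Analysis.Analysis" "HOL-Computational_Algebra.Polynomial"
begin

text \<open>
  The index set \<open>{1, \<dots>, r}\<close> is a finite type \<open>'r\<close> (nonempty, as all types are), so that
  multi-indices are vectors in \<^typ>\<open>nat ^ 'r\<close> and the unit vector \<open>e\<^sub>k\<close> is \<open>axis k 1\<close>.
\<close>

definition mi_size :: "nat ^ 'r \<Rightarrow> nat" where
  "mi_size n = (\<Sum>i\<in>UNIV. n $ i)"

definition is_meixner1 :: "real \<Rightarrow> real ^ 'r \<Rightarrow> nat ^ 'r \<Rightarrow> real poly \<Rightarrow> bool" where
  "is_meixner1 \<beta> c n P \<longleftrightarrow>
     lead_coeff P = 1 \<and> degree P = mi_size n \<and>
     (\<forall>j. \<forall>l < n $ j.
        (\<lambda>k. poly P (real k) * real k ^ l * (pochhammer \<beta> k * (c $ j) ^ k / fact k)) sums 0)"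

text \<open>
  For \<open>\<beta> > 0\<close> and pairwise distinct \<open>c $ j\<close> in \<open>(0, 1)\<close> there is exactly one such polynomial;
  outside this range of parameters the description need not denote.
\<close>

definition meixner1 :: "real \<Rightarrow> real ^ 'r \<Rightarrow> nat ^ 'r \<Rightarrow> real poly" where
  "meixner1 \<beta> c n = (THE P. is_meixner1 \<beta> c n P)"

end

theory Submission imports Defs begin

text \<open>
  For a polynomial \<open>P = \<Sum>\<^sub>m a\<^sub>m x(x-1)\<dots>(x-m+1)\<close> put \<open>G P = \<Sum>\<^sub>m a\<^sub>m (\<beta>)\<^sub>m t\<^sup>m\<close>. Then
  \<open>\<Sum>\<^sub>k P(k) (\<beta>)\<^sub>k c\<^sup>k / k! = (1-c)\<^sup>-\<^sup>\<beta> (G P)(c/(1-c))\<close>, and multiplication of \<open>P\<close> by \<open>x\<close> becomes the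
  operator \<open>q \<mapsto> t(1+t) q' + \<beta> t q\<close>. As \<open>t(1+t)\<close> does not vanish at \<open>t\<^sub>j = c\<^sub>j/(1-c\<^sub>j) > 0\<close>, the
  orthogonality conditions say that \<open>G P\<close> vanishes to order \<open>n\<^sub>j\<close> at \<open>t\<^sub>j\<close>. Since \<open>G\<close> is a
  degree-preserving bijection, the multiple Meixner polynomial is the unique \<open>P\<close> with
  \<open>G P = (\<beta>)\<^sub>|\<^sub>n\<^sub>| \<Prod>\<^sub>j (t - t\<^sub>j)\<^sup>n\<^sup>j\<close>, and the recurrence is the product rule combined with
  \<open>t(1+t) = (t - t\<^sub>j)(t + 1 + t\<^sub>j) + t\<^sub>j(1+t\<^sub>j)\<close>.
\<close>

section \<open>The transform \<open>G\<close> and the operator that represents multiplication by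
  x\<close>

definition meixner_shift :: "real \<Rightarrow> real poly \<Rightarrow> real poly" where
  "meixner_shift \<beta> q = [:0, 1, 1:] * pderiv q + [:0, \<beta>:] * q"

text \<open>Horner form of the map \<open>G\<close>: since x corresponds to
  \<open>meixner_shift\<close>, the polynomial a + x p is sent to a plus the shift of the image of
  p. The falling factorial basis never has to be introduced.\<close>

definition meixner_transform :: "real \<Rightarrow> real poly \<Rightarrow> real poly" where
  "meixner_transform \<beta> p = fold_coeffs (\<lambda>a q. [:a:] + meixner_shift \<beta> q) p 0"

lemma meixner_shift_0 [simp]: "meixner_shift \<beta> 0 = 0"
  by (simp add: meixner_shift_def)

lemma meixner_shift_add: "meixner_shift \<beta> (p + q) = meixner_shift \<beta> p + meixner_shift \<beta> q"
  by (simp add: meixner_shift_def pderiv_add smult_add_right algebra_simps)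

lemma meixner_shift_smult: "meixner_shift \<beta> (smult a p) = smult a (meixner_shift \<beta> p)"
  by (simp add: meixner_shift_def pderiv_smult smult_add_right)

lemma coeff_meixner_shift_0 [simp]: "coeff (meixner_shift \<beta> q) 0 = 0"
  by (simp add: meixner_shift_def)

text \<open>The factor \<beta> + i on the lower coefficient is what accumulates to a Pochhammer
  symbol under iteration.\<close>

lemma coeff_meixner_shift_Suc:
  "coeff (meixner_shift \<beta> q) (Suc i) = real (Suc i) * coeff q (Suc i) + (\<beta> + real i) * coeff q i"
  by (cases i) (simp_all add: meixner_shift_def coeff_pderiv algebra_simps)

lemma meixner_transform_0 [simp]: "meixner_transform \<beta> 0 = 0"
  by (simp add: meixner_transform_def)

lemma meixner_transform_pCons [simp]:
  "meixner_transform \<beta> (pCons a p) = [:a:] + meixner_shift \<beta> (meixner_transform \<beta> p)"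
  \<comment> \<open>\<open>fold_coeffs\<close> unrolls \<open>pCons a p\<close> only if this is not
    the zero polynomial; in the remaining case both sides vanish because the shift fixes 0.\<close>
  by (cases "a = 0 \<and> p = 0") (auto simp: meixner_transform_def)

lemma meixner_transform_add:
  "meixner_transform \<beta> (p + q) = meixner_transform \<beta> p + meixner_transform \<beta> q"
  by (induction p q rule: poly_induct2) (simp_all add: meixner_shift_add)

lemma meixner_transform_smult:
  "meixner_transform \<beta> (smult a p) = smult a (meixner_transform \<beta> p)"
  by (induction p) (simp_all add: meixner_shift_smult smult_add_right)

lemma meixner_transform_diff:
  "meixner_transform \<beta> (p - q) = meixner_transform \<beta> p - meixner_transform \<beta> q"
  using meixner_transform_add[of \<beta> "p - q" q] by simp

lemma meixner_transform_sum:
  "meixner_transform \<beta> (\<Sum>i\<in>A. f i) = (\<Sum>i\<in>A. meixner_transform \<beta> (f i))"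
  by (induction A rule: infinite_finite_induct) (simp_all add: meixner_transform_add)

lemma meixner_transform_monom_mult:
  "meixner_transform \<beta> (monom 1 l * p) = (meixner_shift \<beta> ^^ l) (meixner_transform \<beta> p)"
  by (induction l) (simp_all add: monom_Suc monom_0 flip: one_pCons)

lemma degree_meixner_shift_le: "degree q \<le> d \<Longrightarrow> degree (meixner_shift \<beta> q) \<le> Suc d"
proof (rule degree_le, intro allI impI)
  fix i assume "degree q \<le> d" "Suc d < i"
  then show "coeff (meixner_shift \<beta> q) i = 0"
    by (cases i) (auto simp: coeff_meixner_shift_Suc coeff_eq_0)
qed

text \<open>Each Horner step raises the degree bound by one and multiplies the top coefficient by
  \<beta> + e. Using a bound \<open>d\<close> instead of the exact degree keeps the induction
  uniform when \<open>p\<close> is zero.\<close>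

lemma degree_coeff_meixner_transform:
  assumes "degree p \<le> d"
  shows "degree (meixner_transform \<beta> p) \<le> d \<and>
    coeff (meixner_transform \<beta> p) d = pochhammer \<beta> d * coeff p d"
  using assms
proof (induction p arbitrary: d)
  case 0
  then show ?case by simp
next
  case (pCons a p)
  show ?case
  proof (cases d)
    case 0
    then have "p = 0" using pCons.prems by (auto split: if_splits)
    then show ?thesis using 0 by simp
  next
    case (Suc e)
    then have "degree p \<le> e" using pCons.prems by (auto split: if_splits)
    from pCons.IH[OF this] have
      deg: "degree (meixner_transform \<beta> p) \<le> e" and
      co: "coeff (meixner_transform \<beta> p) e = pochhammer \<beta> e * coeff p e" by auto
    have "degree ([:a:] + meixner_shift \<beta> (meixner_transform \<beta> p)) \<le> Suc e"
      by (intro degree_add_le degree_meixner_shift_le deg) simp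
    moreover have "coeff (meixner_transform \<beta> p) (Suc e) = 0"
      using deg by (simp add: coeff_eq_0)
    ultimately show ?thesis
      by (simp add: Suc coeff_meixner_shift_Suc co pochhammer_Suc)
  qed
qed

lemma degree_meixner_transform:
  assumes "\<beta> > 0"
  shows "degree (meixner_transform \<beta> p) = degree p"
proof (cases "p = 0")
  case False
  then have "coeff (meixner_transform \<beta> p) (degree p) \<noteq> 0"
    using degree_coeff_meixner_transform[of p "degree p" \<beta>] pochhammer_pos[OF assms, of "degree p"]
    by auto
  then show ?thesis
    using degree_coeff_meixner_transform[of p "degree p" \<beta>]
    by (intro antisym[OF _ le_degree]) auto
qed simp

lemma lead_coeff_meixner_transform:
  assumes "\<beta> > 0"
  shows "lead_coeff (meixner_transform \<beta> p) = pochhammer \<beta> (degree p) * lead_coeff p"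
  using degree_coeff_meixner_transform[of p "degree p" \<beta>] by (simp add: degree_meixner_transform assms)

lemma meixner_transform_eq_0_iff:
  assumes "\<beta> > 0"
  shows "meixner_transform \<beta> p = 0 \<longleftrightarrow> p = 0"
  using lead_coeff_meixner_transform[OF assms, of p] pochhammer_pos[OF assms, of "degree p"] by auto

lemma inj_meixner_transform:
  assumes "\<beta> > 0"
  shows "inj (meixner_transform \<beta>)"
proof (rule injI)
  fix p q assume "meixner_transform \<beta> p = meixner_transform \<beta> q"
  then show "p = q"
    using meixner_transform_eq_0_iff[OF assms, of "p - q"] by (simp add: meixner_transform_diff)
qed

text \<open>In the monomial bases \<open>G\<close> is triangular with diagonal entries
  \<open>pochhammer \<beta> d\<close>, nonzero for \<beta> > 0, so a preimage is built by
  eliminating top coefficients.\<close>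

lemma surj_meixner_transform:
  assumes "\<beta> > 0"
  shows "\<exists>p. meixner_transform \<beta> p = q"
proof -
  have "\<exists>p. meixner_transform \<beta> p = q" if "\<And>i. i \<ge> d \<Longrightarrow> coeff q i = 0" for d q
    using that
  proof (induction d arbitrary: q)
    case 0
    then have "q = 0" by (intro poly_eqI) simp
    then show ?case by (intro exI[of _ 0]) simp
  next
    case (Suc d)
    define m where "m = monom (coeff q d / pochhammer \<beta> d) d"
    have m: "degree (meixner_transform \<beta> m) \<le> d" "coeff (meixner_transform \<beta> m) d = coeff q d"
      using degree_coeff_meixner_transform[of m d \<beta>] pochhammer_pos[OF assms, of d]
      by (auto simp: m_def degree_monom_le)
    have "coeff (q - meixner_transform \<beta> m) i = 0" if "i \<ge> d" for i
      using m Suc.prems[of i] that by (cases "i = d") (auto simp: coeff_eq_0)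
    from Suc.IH[OF this] obtain p where "meixner_transform \<beta> p = q - meixner_transform \<beta> m"
      by blast
    then have "meixner_transform \<beta> (p + m) = q" by (simp add: meixner_transform_add)
    then show ?case by blast
  qed
  from this[of "Suc (degree q)" q] show ?thesis by (simp add: coeff_eq_0)
qed

section \<open>Power series sums against the negative binomial weight\<close>

lemma negative_binomial_sums:
  fixes \<beta> c :: real
  assumes "\<bar>c\<bar> < 1"
  shows "(\<lambda>k. pochhammer \<beta> k / fact k * c ^ k) sums ((1 - c) powr - \<beta>)"
proof -
  have "(- \<beta> gchoose k) * (- c) ^ k = pochhammer \<beta> k / fact k * c ^ k" for k
    by (simp add: gbinomial_pochhammer power_minus[of c])
  with gen_binomial_real[of "- c" "- \<beta>"] assms show ?thesis by simp
qed

text \<open>Termwise differentiation, in the form of the operator y d/dy, which multiplies the k-th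
  term by k. It turns a sum for p into the sum for x p.\<close>

lemma power_series_theta_sums:
  fixes a :: "nat \<Rightarrow> real"
  assumes sums: "\<And>y. \<bar>y\<bar> < 1 \<Longrightarrow> (\<lambda>k. a k * y ^ k) sums f y"
    and "(f has_field_derivative D) (at y)" and y: "\<bar>y\<bar> < 1"
  shows "(\<lambda>k. real k * a k * y ^ k) sums (y * D)"
proof -
  have summ: "summable (\<lambda>k. a k * y ^ k)" if "norm y < 1" for y
    using sums[of y] that by (auto simp: sums_iff)
  obtain K where K: "\<bar>y\<bar> < K" "K < 1" using y dense by blast
  have "DERIV (\<lambda>x. \<Sum>k. a k * x ^ k) y :> (\<Sum>k. diffs a k * y ^ k)"
    by (rule termdiffs_strong[of _ K]) (use K in \<open>auto intro!: summ\<close>)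
  moreover have "DERIV (\<lambda>x. \<Sum>k. a k * x ^ k) y :> D"
  proof (rule has_field_derivative_transform_within_open[OF assms(2)])
    show "open {-1<..<1::real}" "y \<in> {-1<..<1}" using y by auto
    show "f x = (\<Sum>k. a k * x ^ k)" if "x \<in> {-1<..<1}" for x
      using sums[of x] that by (auto simp: sums_iff)
  qed
  ultimately have D: "(\<Sum>k. diffs a k * y ^ k) = D" by (rule DERIV_unique)
  have "summable (\<lambda>k. diffs a k * y ^ k)"
    by (rule termdiff_converges[of _ 1]) (use y summ in auto)
  from sums_mult[OF diffs_equiv[OF this], of y]
  have "(\<lambda>k. y * (real k * a k * y ^ (k - Suc 0))) sums (y * D)" by (simp add: D)
  \<comment> \<open>At k = 0 the truncated exponent is harmless, since the factor k
    vanishes.\<close>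
  moreover have "y * (real k * a k * y ^ (k - Suc 0)) = real k * a k * y ^ k" for k
    by (cases k) auto
  ultimately show ?thesis by simp
qed

text \<open>Induction along Horner's scheme: the constant contributes a negative binomial series,
  and the factor k is c d/dc applied to the induction hypothesis, which is therefore needed on the
  whole disc.\<close>

lemma meixner_weight_sums:
  assumes "\<bar>c\<bar> < 1"
  shows "(\<lambda>k. poly p (real k) * (pochhammer \<beta> k / fact k) * c ^ k) sums
    ((1 - c) powr - \<beta> * poly (meixner_transform \<beta> p) (c / (1 - c)))"
  using assms
proof (induction p arbitrary: c)
  case 0
  then show ?case by simp
next
  case (pCons a p)
  define g where "g = meixner_transform \<beta> p"
  define t where "t = c / (1 - c)"
  have c: "1 - c > 0" using pCons.prems by auto
  have "((\<lambda>y. (1 - y) powr - \<beta> * poly g (y / (1 - y))) has_field_derivative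
      ((1 - c) powr - \<beta> * (\<beta> / (1 - c) * poly g t + poly (pderiv g) t / (1 - c)\<^sup>2))) (at c)"
    using c unfolding t_def
    apply (auto intro!: derivative_eq_intros DERIV_chain2[OF poly_DERIV] simp: powr_diff)
    apply (simp add: field_simps power2_eq_square)
    done
  from power_series_theta_sums[OF pCons.IH[folded g_def] this pCons.prems]
  have "(\<lambda>k. real k * (poly p (real k) * (pochhammer \<beta> k / fact k)) * c ^ k) sums
    (c * ((1 - c) powr - \<beta> * (\<beta> / (1 - c) * poly g t + poly (pderiv g) t / (1 - c)\<^sup>2)))" by simp
  also have "c * ((1 - c) powr - \<beta> * (\<beta> / (1 - c) * poly g t + poly (pderiv g) t / (1 - c)\<^sup>2)) =
    (1 - c) powr - \<beta> * poly (meixner_shift \<beta> g) t"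
  proof -
    \<comment> \<open>This is c dt/dc, the chain rule factor; differentiating the power of 1 - c
      supplies the other term, \<beta> t.\<close>
    have "t * (1 + t) = c / (1 - c)\<^sup>2" using c by (simp add: t_def field_simps power2_eq_square)
    moreover have "poly (meixner_shift \<beta> g) t = t * (1 + t) * poly (pderiv g) t + \<beta> * t * poly g t"
      by (simp add: meixner_shift_def algebra_simps)
    ultimately have "poly (meixner_shift \<beta> g) t =
      c / (1 - c)\<^sup>2 * poly (pderiv g) t + \<beta> * (c / (1 - c)) * poly g t"
      by (simp only: t_def)
    then show ?thesis by (simp add: algebra_simps)
  qed
  finally have "(\<lambda>k. real k * (poly p (real k) * (pochhammer \<beta> k / fact k)) * c ^ k) sums
    ((1 - c) powr - \<beta> * poly (meixner_shift \<beta> g) t)" .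
  from sums_add[OF sums_mult[OF negative_binomial_sums[OF pCons.prems], of a \<beta>] this]
  show ?case by (simp add: g_def[symmetric] t_def[symmetric] algebra_simps)
qed

section \<open>Vanishing order at a positive point\<close>

text \<open>The shift lowers the order m of a root t > 0 by exactly one: t(1+t) is nonzero there, so
  the derivative term has order m - 1, while \<beta> t q has order at least m.\<close>

lemma linear_power_dvd_of_meixner_shift:
  assumes t: "t > 0" and "poly q t = 0" and dvd: "[:- t, 1:] ^ n dvd meixner_shift \<beta> q"
  shows "[:- t, 1:] ^ Suc n dvd q"
proof (rule ccontr)
  assume not: "\<not> [:- t, 1:] ^ Suc n dvd q"
  then have q: "q \<noteq> 0" by auto
  define m where "m = order t q"
  have m: "m = Suc (order t (pderiv q))"
    unfolding m_def using q assms(2) by (rule order_pderiv)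
  have "pderiv q \<noteq> 0"
  proof
    assume "pderiv q = 0"
    then obtain h where "q = [:h:]" using pderiv_iszero by blast
    then show False using q \<open>poly q t = 0\<close> by simp
  qed
  \<comment> \<open>If the claim failed, the m-th power would divide both the shift and its term
    \<open>[:0, \<beta>:] * q\<close>, hence also the derivative term, whose order is only m -
    1.\<close>
  have "m \<le> n" using not q by (simp add: order_divides m_def del: power_Suc)
  then have "[:- t, 1:] ^ m dvd meixner_shift \<beta> q" using dvd power_le_dvd by blast
  moreover have "[:- t, 1:] ^ m dvd [:0, \<beta>:] * q" unfolding m_def by (intro dvd_mult order_1)
  ultimately have "[:- t, 1:] ^ m dvd [:0, 1, 1:] * pderiv q"
    unfolding meixner_shift_def using dvd_add_left_iff by blast
  moreover have nz: "[:0, 1, 1:] * pderiv q \<noteq> 0"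
    using \<open>pderiv q \<noteq> 0\<close> unfolding mult_eq_0_iff by simp
  ultimately have "m \<le> order t [:0, 1, 1:] + order t (pderiv q)"
    unfolding order_divides order_mult[OF nz] by blast
  moreover have "order t [:0, 1, 1::real:] = 0"
  proof (rule order_0I)
    show "poly [:0, 1, 1:] t \<noteq> 0" using t by auto
  qed
  ultimately show False using m by simp
qed

lemma meixner_shift_dvd:
  assumes "[:- t, 1:] ^ Suc n dvd q"
  shows "[:- t, 1:] ^ n dvd meixner_shift \<beta> q"
proof -
  obtain s where s: "q = [:- t, 1:] ^ Suc n * s" using assms by (auto elim: dvdE)
  have "[:- t, 1:] ^ n dvd pderiv q"
    unfolding s lemma_order_pderiv1
    by (intro dvd_add dvd_smult[OF dvd_triv_right] dvd_mult2[OF le_imp_power_dvd]) simp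
  moreover have "[:- t, 1:] ^ n dvd q" unfolding s by (intro dvd_mult2 le_imp_power_dvd) simp
  ultimately show ?thesis unfolding meixner_shift_def by (intro dvd_add dvd_mult)
qed

text \<open>Induction on \<open>n\<close>, peeling off l = 0: the remaining conditions are those of
  length \<open>n\<close> for the shift of \<open>q\<close>, whose order at t is one less.\<close>

lemma meixner_shift_iterates_vanish_iff:
  assumes t: "t > 0"
  shows "(\<forall>l<n. poly ((meixner_shift \<beta> ^^ l) q) t = 0) \<longleftrightarrow> [:- t, 1:] ^ n dvd q"
proof (induction n arbitrary: q)
  case (Suc n)
  have "(\<forall>l<Suc n. poly ((meixner_shift \<beta> ^^ l) q) t = 0) \<longleftrightarrow>
    poly q t = 0 \<and> (\<forall>l<n. poly ((meixner_shift \<beta> ^^ l) (meixner_shift \<beta> q)) t = 0)"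
    by (auto simp: less_Suc_eq_0_disj funpow_swap1)
  also have "\<dots> \<longleftrightarrow> poly q t = 0 \<and> [:- t, 1:] ^ n dvd meixner_shift \<beta> q" by (simp only: Suc.IH)
  also have "\<dots> \<longleftrightarrow> [:- t, 1:] ^ Suc n dvd q"
  proof
    assume dvd: "[:- t, 1:] ^ Suc n dvd q"
    then have "[:- t, 1:] dvd q" unfolding power_Suc by (rule dvd_mult_left)
    then show "poly q t = 0 \<and> [:- t, 1:] ^ n dvd meixner_shift \<beta> q"
      using meixner_shift_dvd[OF dvd] by (simp add: poly_eq_0_iff_dvd)
  qed (use linear_power_dvd_of_meixner_shift[OF t] in blast)
  finally show ?case .
qed simp

section \<open>Products of linear powers and node polynomials\<close>

text \<open>As the points are distinct, the product over the other indices does not vanish at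
  \<open>t i\<close>; the full order \<open>n i\<close> therefore sits in the cofactor
  \<open>s\<close>.\<close>

lemma prod_linear_power_dvd:
  fixes t :: "'a \<Rightarrow> 'b :: idom" and n :: "'a \<Rightarrow> nat"
  assumes "finite A" "inj_on t A" "g \<noteq> 0" "\<And>j. j \<in> A \<Longrightarrow> [:- t j, 1:] ^ n j dvd g"
  shows "(\<Prod>j\<in>A. [:- t j, 1:] ^ n j) dvd g"
  using assms
proof (induction A)
  case (insert i A)
  define Q where "Q = (\<Prod>j\<in>A. [:- t j, 1:] ^ n j)"
  have "Q dvd g" unfolding Q_def using insert by auto
  then obtain s where s: "g = Q * s" by (auto elim: dvdE)
  have "t i \<noteq> t j" if "j \<in> A" for j
    using insert.prems(1) insert.hyps(2) that by (auto simp: inj_on_def)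
  then have "poly Q (t i) \<noteq> 0"
    using insert.hyps(1) by (simp add: Q_def poly_prod)
  then have "order (t i) Q = 0" by (rule order_0I)
  then have "[:- t i, 1:] ^ n i dvd s"
    using insert.prems(2) insert.prems(3)[of i] order_mult[of Q s "t i"] by (auto simp: s order_divides)
  then have "[:- t i, 1:] ^ n i * Q dvd g" unfolding s by (simp add: mult.commute mult_dvd_mono)
  then show ?case using insert.hyps by (simp add: Q_def)
qed simp

definition node_poly :: "('r \<Rightarrow> 'a) \<Rightarrow> nat ^ 'r::finite \<Rightarrow> 'a::idom poly" where
  "node_poly t n = (\<Prod>j\<in>UNIV. [:- t j, 1:] ^ (n $ j))"

lemma degree_node_poly: "degree (node_poly t n) = mi_size n"
  unfolding node_poly_def mi_size_def
  by (subst degree_prod_sum_eq) (auto simp: degree_linear_power)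

lemma lead_coeff_node_poly: "lead_coeff (node_poly t n) = 1"
  by (simp add: node_poly_def lead_coeff_prod lead_coeff_power)

lemma node_poly_nonzero: "node_poly t n \<noteq> 0"
  using lead_coeff_node_poly[of t n] by auto

lemma node_poly_add: "node_poly t (n + m) = node_poly t n * node_poly t m"
  by (simp add: node_poly_def power_add prod.distrib)

lemma node_poly_axis: "node_poly t (axis k 1) = [:- t k, 1:]"
proof -
  have "node_poly t (axis k 1) = (\<Prod>j\<in>UNIV. if j = k then [:- t k, 1:] else 1)"
    unfolding node_poly_def by (intro prod.cong) (auto simp: axis_def)
  then show ?thesis by simp
qed

lemma axis_diff_add:
  fixes n :: "nat ^ 'r::finite"
  assumes "n $ j > 0"
  shows "n - axis j 1 + axis j 1 = n"
  using assms by (auto simp: vec_eq_iff axis_def)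

lemma node_poly_diff_axis:
  assumes "n $ j > 0"
  shows "node_poly t n = [:- t j, 1:] * node_poly t (n - axis j 1)"
  using node_poly_add[of t "n - axis j 1" "axis j 1"]
  unfolding axis_diff_add[OF assms] node_poly_axis by (simp only: mult.commute)

lemma mi_size_add: "mi_size (n + m) = mi_size n + mi_size m"
  by (simp add: mi_size_def sum.distrib)

lemma mi_size_axis: "mi_size (axis k 1) = 1"
  by (simp add: mi_size_def axis_def)

lemma pderiv_node_poly:
  fixes t :: "'r::finite \<Rightarrow> 'a::{idom,semiring_char_0}"
  shows "pderiv (node_poly t n) = (\<Sum>j\<in>UNIV. smult (of_nat (n $ j)) (node_poly t (n - axis j 1)))"
proof -
  have "(\<Prod>i\<in>UNIV - {j}. [:- t i, 1:] ^ (n $ i)) * pderiv ([:- t j, 1:] ^ (n $ j)) =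
    smult (of_nat (n $ j)) (node_poly t (n - axis j 1))" for j
  proof -
    \<comment> \<open>This also holds for \<open>n $ j = 0\<close>: both subtractions are truncated,
      and the factor \<open>n $ j\<close> later removes the term.\<close>
    have "node_poly t (n - axis j 1) =
      [:- t j, 1:] ^ (n $ j - 1) * (\<Prod>i\<in>UNIV - {j}. [:- t i, 1:] ^ (n $ i))"
      unfolding node_poly_def by (subst prod.remove[of _ j]) (auto simp: axis_def intro!: prod.cong)
    then show ?thesis by (simp add: pderiv_power pderiv_pCons mult.commute)
  qed
  then show ?thesis unfolding node_poly_def[of t n] pderiv_prod by simp
qed

section \<open>Multiple Meixner polynomials through their transforms\<close>

locale meixner_parameters =
  fixes \<beta> :: real and c :: "real ^ 'r::finite"
  assumes \<beta>_pos: "\<beta> > 0"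
    and c_bounds: "\<And>i. 0 < c $ i \<and> c $ i < 1"
    and c_distinct: "\<And>i j. i \<noteq> j \<Longrightarrow> c $ i \<noteq> c $ j"
begin

definition node :: "'r \<Rightarrow> real" where
  "node j = c $ j / (1 - c $ j)"

lemma node_pos: "node j > 0"
  using c_bounds[of j] by (simp add: node_def)

lemma one_plus_node: "1 + node j = 1 / (1 - c $ j)"
  using c_bounds[of j] by (simp add: node_def field_simps)

lemma inj_node: "inj node"
proof (rule injI, rule ccontr)
  fix i j assume "node i = node j" "i \<noteq> j"
  then show False
    using c_distinct[of i j] one_plus_node[of i] one_plus_node[of j] c_bounds[of i] c_bounds[of j]
    by (simp add: field_simps)
qed

text \<open>The factor k^l is multiplication by \<open>monom 1 l\<close>, hence l shifts after the
  transform; the power of 1 - c_j in front is nonzero and can be cancelled.\<close>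

lemma orthogonality_iff:
  "(\<lambda>k. poly P (real k) * real k ^ l * (pochhammer \<beta> k * (c $ j) ^ k / fact k)) sums 0 \<longleftrightarrow>
    poly ((meixner_shift \<beta> ^^ l) (meixner_transform \<beta> P)) (node j) = 0"
proof -
  have "(\<lambda>k. poly (monom 1 l * P) (real k) * (pochhammer \<beta> k / fact k) * (c $ j) ^ k) sums
    ((1 - c $ j) powr - \<beta> * poly (meixner_transform \<beta> (monom 1 l * P)) (node j))"
    unfolding node_def by (rule meixner_weight_sums) (use c_bounds[of j] in auto)
  moreover have "(\<lambda>k. poly (monom 1 l * P) (real k) * (pochhammer \<beta> k / fact k) * (c $ j) ^ k) =
    (\<lambda>k. poly P (real k) * real k ^ l * (pochhammer \<beta> k * (c $ j) ^ k / fact k))"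
    by (simp add: poly_monom fun_eq_iff)
  ultimately have S: "(\<lambda>k. poly P (real k) * real k ^ l * (pochhammer \<beta> k * (c $ j) ^ k / fact k)) sums
    ((1 - c $ j) powr - \<beta> * poly ((meixner_shift \<beta> ^^ l) (meixner_transform \<beta> P)) (node j))"
    by (simp add: meixner_transform_monom_mult)
  have "(1 - c $ j) powr - \<beta> \<noteq> 0" using c_bounds[of j] by auto
  then show ?thesis using S sums_unique2[OF S, of 0] by auto
qed

lemma is_meixner1_iff_dvd:
  "is_meixner1 \<beta> c n P \<longleftrightarrow> lead_coeff P = 1 \<and> degree P = mi_size n \<and>
    (\<forall>j. [:- node j, 1:] ^ (n $ j) dvd meixner_transform \<beta> P)"
  by (simp only: is_meixner1_def orthogonality_iff meixner_shift_iterates_vanish_iff[OF node_pos])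

text \<open>The divisibility conditions combine into divisibility by
  \<open>node_poly node n\<close>. Its degree equals that of the transform, so the quotient is a
  constant, and monicity of \<open>P\<close> determines it.\<close>

lemma is_meixner1_iff:
  "is_meixner1 \<beta> c n P \<longleftrightarrow>
    meixner_transform \<beta> P = smult (pochhammer \<beta> (mi_size n)) (node_poly node n)"
proof
  assume "is_meixner1 \<beta> c n P"
  then have P: "lead_coeff P = 1" "degree P = mi_size n"
    "\<And>j. [:- node j, 1:] ^ (n $ j) dvd meixner_transform \<beta> P"
    by (auto simp: is_meixner1_iff_dvd)
  then have nz: "meixner_transform \<beta> P \<noteq> 0"
    by (auto simp: meixner_transform_eq_0_iff[OF \<beta>_pos])
  have "node_poly node n dvd meixner_transform \<beta> P"
    unfolding node_poly_def by (rule prod_linear_power_dvd) (use inj_node nz P in auto)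
  then obtain s where s: "meixner_transform \<beta> P = node_poly node n * s" by (auto elim: dvdE)
  have "s \<noteq> 0" using nz s by auto
  have "degree (node_poly node n * s) = mi_size n"
    unfolding s[symmetric] by (simp add: degree_meixner_transform[OF \<beta>_pos] P)
  then have "degree s = 0"
    using \<open>s \<noteq> 0\<close> by (simp add: degree_mult_eq node_poly_nonzero degree_node_poly)
  then obtain a where a: "s = [:a:]" by (rule degree_eq_zeroE)
  have "lead_coeff (node_poly node n * s) = pochhammer \<beta> (mi_size n)"
    using lead_coeff_meixner_transform[OF \<beta>_pos, of P] unfolding s[symmetric] P(1) by (simp add: P(2))
  then have "a = pochhammer \<beta> (mi_size n)"
    by (simp only: lead_coeff_mult lead_coeff_node_poly) (simp add: a)
  then show "meixner_transform \<beta> P = smult (pochhammer \<beta> (mi_size n)) (node_poly node n)"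
    by (simp add: s a)
next
  assume eq: "meixner_transform \<beta> P = smult (pochhammer \<beta> (mi_size n)) (node_poly node n)"
  have poch: "pochhammer \<beta> (mi_size n) > 0" by (rule pochhammer_pos[OF \<beta>_pos])
  have deg: "degree P = mi_size n"
    using degree_meixner_transform[OF \<beta>_pos, of P] poch by (simp add: eq degree_node_poly)
  have "pochhammer \<beta> (mi_size n) * lead_coeff P = pochhammer \<beta> (mi_size n)"
    using lead_coeff_meixner_transform[OF \<beta>_pos, of P] unfolding eq lead_coeff_smult
    by (simp add: lead_coeff_node_poly deg)
  then have "lead_coeff P = 1" using poch by simp
  moreover have "[:- node j, 1:] ^ (n $ j) dvd meixner_transform \<beta> P" for j
    unfolding eq node_poly_def by (intro dvd_smult dvd_prodI) auto
  ultimately show "is_meixner1 \<beta> c n P" using deg by (simp add: is_meixner1_iff_dvd)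
qed

text \<open>Bijectivity of the transform gives existence and uniqueness, so the definite description
  denotes.\<close>

lemma meixner_transform_meixner1:
  "meixner_transform \<beta> (meixner1 \<beta> c n) = smult (pochhammer \<beta> (mi_size n)) (node_poly node n)"
proof -
  obtain P where P: "meixner_transform \<beta> P = smult (pochhammer \<beta> (mi_size n)) (node_poly node n)"
    using surj_meixner_transform[OF \<beta>_pos] by blast
  have "Q = P" if "is_meixner1 \<beta> c n Q" for Q
    by (rule injD[OF inj_meixner_transform[OF \<beta>_pos]]) (use that in \<open>simp add: is_meixner1_iff P\<close>)
  moreover have "is_meixner1 \<beta> c n P" by (simp add: is_meixner1_iff P)
  ultimately have "is_meixner1 \<beta> c n (meixner1 \<beta> c n)"
    unfolding meixner1_def by (rule theI[rotated])
  then show ?thesis by (simp add: is_meixner1_iff)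
qed

section \<open>The recurrence\<close>

lemma meixner_shift_node_poly:
  "meixner_shift \<beta> (node_poly node n) =
      smult (\<beta> + real (mi_size n)) (node_poly node (n + axis k 1))
    + smult ((\<beta> + real (mi_size n)) * node k + (\<Sum>i\<in>UNIV. real (n $ i) * (1 + node i))) (node_poly node n)
    + (\<Sum>j\<in>UNIV. smult (real (n $ j) * (node j * (1 + node j))) (node_poly node (n - axis j 1)))"
proof -
  let ?Q = "node_poly node"
  let ?N = "real (mi_size n)"
  \<comment> \<open>For \<open>n $ j > 0\<close> one factor t - t_j of t(1+t) - t_j(1+t_j) is
    absorbed to restore \<open>?Q n\<close>; for \<open>n $ j = 0\<close> both sides are 0.\<close>
  have split: "[:0, 1, 1:] * smult (real (n $ j)) (?Q (n - axis j 1)) =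
    smult (real (n $ j)) ([:1 + node j, 1:] * ?Q n)
      + smult (real (n $ j) * (node j * (1 + node j))) (?Q (n - axis j 1))" for j
  proof (cases "n $ j = 0")
    case False
    have "[:0, 1, 1:] = [:1 + node j, 1:] * [:- node j, 1:] + smult (node j * (1 + node j)) 1"
      by (simp add: algebra_simps)
    moreover have "?Q n = [:- node j, 1:] * ?Q (n - axis j 1)"
      using False by (intro node_poly_diff_axis) simp
    ultimately have "[:0, 1, 1:] * ?Q (n - axis j 1) =
      [:1 + node j, 1:] * ?Q n + smult (node j * (1 + node j)) (?Q (n - axis j 1))"
      by (simp only: distrib_right mult.assoc mult_smult_left mult_1_left)
    then show ?thesis
      by (simp only: mult_smult_right smult_add_right smult_smult)
  qed simp
  have lin: "(\<Sum>j\<in>UNIV. smult (real (n $ j)) [:1 + node j, 1:]) =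
      [:\<Sum>i\<in>UNIV. real (n $ i) * (1 + node i), ?N:]"
    by (rule poly_eqI)
       (auto simp: coeff_sum coeff_pCons mi_size_def split: nat.splits)
  have "meixner_shift \<beta> (?Q n) = (\<Sum>j\<in>UNIV. smult (real (n $ j)) [:1 + node j, 1:]) * ?Q n
    + (\<Sum>j\<in>UNIV. smult (real (n $ j) * (node j * (1 + node j))) (?Q (n - axis j 1)))
    + [:0, \<beta>:] * ?Q n"
    unfolding meixner_shift_def pderiv_node_poly sum_distrib_left split sum.distrib sum_distrib_right
    by (simp only: mult_smult_left)
  \<comment> \<open>The linear factor multiplying \<open>?Q n\<close> is expanded around the node of
    the arbitrary index \<open>k\<close>; its part (\<beta> + N)(t - t_k) raises \<open>n\<close> in
    direction \<open>k\<close>.\<close>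
  moreover have "[:\<Sum>i\<in>UNIV. real (n $ i) * (1 + node i), ?N:] + [:0, \<beta>:] =
    smult (\<beta> + ?N) [:- node k, 1:]
      + smult ((\<beta> + ?N) * node k + (\<Sum>i\<in>UNIV. real (n $ i) * (1 + node i))) 1"
    by simp
  then have "[:\<Sum>i\<in>UNIV. real (n $ i) * (1 + node i), ?N:] * ?Q n + [:0, \<beta>:] * ?Q n =
    smult (\<beta> + ?N) (?Q (n + axis k 1))
    + smult ((\<beta> + ?N) * node k + (\<Sum>i\<in>UNIV. real (n $ i) * (1 + node i))) (?Q n)"
    unfolding node_poly_add node_poly_axis distrib_right[symmetric]
    by (simp only: distrib_right mult_smult_left mult_1_left mult.commute[of "?Q n"])
  ultimately show ?thesis unfolding lin by (simp add: algebra_simps)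
qed

text \<open>By injectivity it suffices to compare transforms, where multiplication by x becomes the
  shift of a node polynomial. Only the Pochhammer normalizations remain to be matched.\<close>

lemma meixner1_recurrence:
  "pCons 0 (meixner1 \<beta> c n) =
      meixner1 \<beta> c (n + axis k 1)
    + smult ((\<beta> + real (mi_size n)) * node k + (\<Sum>i\<in>UNIV. real (n $ i) * (1 + node i))) (meixner1 \<beta> c n)
    + (\<Sum>j\<in>UNIV. smult (real (n $ j) * (node j * (1 + node j)) * (\<beta> + real (mi_size n) - 1))
        (meixner1 \<beta> c (n - axis j 1)))"
  (is "?l = ?r")
proof -
  \<comment> \<open>Raising the index turns (\<beta>)_N into (\<beta>)_N (\<beta> + N), which
    accounts for the factor \<beta> + N in the shift formula.\<close>
  have up: "smult (pochhammer \<beta> (mi_size (n + axis k 1))) q =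
      smult (pochhammer \<beta> (mi_size n)) (smult (\<beta> + real (mi_size n)) q)" for q
    by (simp add: mi_size_add mi_size_axis[unfolded One_nat_def] pochhammer_Suc)
  have mid: "smult b (smult (pochhammer \<beta> (mi_size n)) (node_poly node n)) =
      smult (pochhammer \<beta> (mi_size n)) (smult b (node_poly node n))" for b
    by (simp add: mult.commute)
  \<comment> \<open>Lowering the index leaves (\<beta>)_(N-1), and the coefficient \<beta> + N - 1
    completes it to (\<beta>)_N. If \<open>n $ j = 0\<close>, both sides are 0.\<close>
  have down: "smult (real (n $ j) * w * (\<beta> + real (mi_size n) - 1))
        (smult (pochhammer \<beta> (mi_size (n - axis j 1))) q) =
      smult (pochhammer \<beta> (mi_size n)) (smult (real (n $ j) * w) q)" for j w q
  proof (cases "n $ j = 0")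
    case False
    then have "mi_size n = Suc (mi_size (n - axis j 1))"
      using mi_size_add[of "n - axis j 1" "axis j 1"] axis_diff_add[of n j] False
      by (simp add: mi_size_axis[unfolded One_nat_def])
    then show ?thesis by (simp add: pochhammer_Suc mult_ac)
  qed simp
  have smult_sum: "smult a (\<Sum>j\<in>UNIV. f j) = (\<Sum>j\<in>UNIV. smult a (f j))"
    for a and f :: "'r \<Rightarrow> real poly"
    using sum_distrib_left[of "[:a:]" f UNIV] by simp
  have "meixner_transform \<beta> ?l = meixner_transform \<beta> ?r"
    by (simp only: meixner_transform_pCons pCons_0_0 add_0_left
        meixner_transform_add meixner_transform_smult meixner_transform_sum
        meixner_transform_meixner1 meixner_shift_smult meixner_shift_node_poly[of n k]
        up mid down smult_add_right smult_sum)
  then show ?thesis using inj_meixner_transform[OF \<beta>_pos] by (simp add: inj_def)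
qed

end

theorem theorem3:
  fixes \<beta> :: real and c :: "real ^ 'r" and n :: "nat ^ 'r" and k :: 'r and x :: real
  assumes "\<beta> > 0"
    and "\<And>i. 0 < c $ i \<and> c $ i < 1"
    and "\<And>i j. i \<noteq> j \<Longrightarrow> c $ i \<noteq> c $ j"
  shows "x * poly (meixner1 \<beta> c n) x =
      poly (meixner1 \<beta> c (n + axis k 1)) x
    + ((\<beta> + real (mi_size n)) * (c $ k / (1 - c $ k))
        + (\<Sum>i\<in>UNIV. real (n $ i) / (1 - c $ i))) * poly (meixner1 \<beta> c n) x
    + (\<Sum>j\<in>UNIV. c $ j * real (n $ j) / (1 - c $ j)\<^sup>2 * (\<beta> + real (mi_size n) - 1)
        * poly (meixner1 \<beta> c (n - axis j 1)) x)"
proof -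
  interpret meixner_parameters \<beta> c
    by unfold_locales (use assms in auto)
  \<comment> \<open>Back to the parameters: t_j(1+t_j) = c_j/(1-c_j)^2. The rest is evaluation of
    the polynomial identity at \<open>x\<close>.\<close>
  have weight: "real (n $ j) * (node j * (1 + node j)) = c $ j * real (n $ j) / (1 - c $ j)\<^sup>2" for j
    unfolding one_plus_node by (simp add: node_def power2_eq_square)
  show ?thesis
    using arg_cong[OF meixner1_recurrence[of n k], of "\<lambda>p. poly p x"]
    unfolding weight unfolding one_plus_node
    by (simp add: poly_sum node_def)
qed

end
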